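(* Let $p\colon E\to B$ be a simplicial map between simplicial complexes. The following three properties of $p$ are equivalent. (Type I) For every simplicial complex $K$, for any two contiguous simplicial maps $f,g\colon K\to B$, $f\sim_c g$, and any simplicial map $\tilde f\colon K\to E$ with $p\circ\tilde f=f$, there exists a simplicial map $\tilde g\colon K\to E$ such that $\tilde f\sim_c\tilde g$ and $p\circ\tilde g=g$. (Type II) For every simplicial complex $K$, for every $m\geq 1$, for any two simplicial maps $f,g\colon K\to B$ in the same contiguity class with $m$ steps, and any simplicial map $\tilde f\colon K\to E$ with $p\circ\tilde f=f$, there exists a simplicial map $\tilde g\colon K\to E$ such that $\tilde f$ and $\tilde g$ are in the same contiguity class with $m$ steps and $p\circ\tilde g=g$. (Type III) For every simplicial complex $K$, every $m\geq 1$, and all simplicial maps $H\colon K\times I_m\to B$ and $\varphi\colon K\times\{0\}\to E$ with $p(\varphi(v,0))=H(v,0)$ for all vertices $v$ of $K$, there exists a simplicial map $\widetilde H\colon K\times I_m\to E$ such that $\widetilde H(v,0)=\varphi(v,0)$ for all vertices $v$ of $K$ and $p\circ\widetilde H=H$.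
   Context: Simplicial complexes are abstract simplicial complexes, not necessarily finite; a simplicial map is a map of vertex sets sending simplices to simplices. Two simplicial maps $\varphi,\psi\colon K\to L$ are contiguous, $\varphi\sim_c\psi$, if $\varphi(\sigma)\cup\psi(\sigma)$ is a simplex of $L$ for every simplex $\sigma$ of $K$. They are in the same contiguity class with $m$ steps if there is a sequence $\varphi=\varphi_0\sim_c\varphi_1\sim_c\cdots\sim_c\varphi_m=\psi$ of simplicial maps $K\to L$ with consecutive ones contiguous. For $m\geq1$, $I_m$ is the one-dimensional simplicial complex with vertices $0,1,\dots,m$ and edges $\{j,j+1\}$, $0\le j<m$. The (categorical) product $K\times L$ has vertex set $V(K)\times V(L)$, and a finite set of vertices $\sigma$ is a simplex of $K\times L$ iff its two projections are simplices of $K$ and of $L$ respectively. In all three properties the complex $K$ may be finite or infinite. *)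

theory Defs
  imports Main
begin

text \<open>
  An abstract simplicial complex is given by its set of simplices, which are finite and nonempty;
  the empty set is not counted as a simplex. The vertices are the points lying in some simplex.
\<close>

definition simplicial_complex :: "'a set set \<Rightarrow> bool" where
  "simplicial_complex K \<longleftrightarrow>
     (\<forall>\<sigma>\<in>K. finite \<sigma> \<and> \<sigma> \<noteq> {}) \<and>
     (\<forall>\<sigma>\<in>K. \<forall>\<tau>. \<tau> \<subseteq> \<sigma> \<and> \<tau> \<noteq> {} \<longrightarrow> \<tau> \<in> K)"

definition vertices :: "'a set set \<Rightarrow> 'a set" where
  "vertices K = \<Union>K"

text \<open>
  Maps of vertex sets are total functions whose values outside \<open>vertices K\<close> are irrelevant.
  Hence equality of maps out of \<open>K\<close> is always stated on \<open>vertices K\<close> only.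
\<close>

definition simplicial_map :: "'a set set \<Rightarrow> 'b set set \<Rightarrow> ('a \<Rightarrow> 'b) \<Rightarrow> bool" where
  "simplicial_map K L f \<longleftrightarrow>
     (\<forall>v\<in>vertices K. f v \<in> vertices L) \<and> (\<forall>\<sigma>\<in>K. f ` \<sigma> \<in> L)"

definition contiguous :: "'a set set \<Rightarrow> 'b set set \<Rightarrow> ('a \<Rightarrow> 'b) \<Rightarrow> ('a \<Rightarrow> 'b) \<Rightarrow> bool" where
  "contiguous K L f g \<longleftrightarrow>
     simplicial_map K L f \<and> simplicial_map K L g \<and> (\<forall>\<sigma>\<in>K. f ` \<sigma> \<union> g ` \<sigma> \<in> L)"

definition same_contiguity_class ::
  "nat \<Rightarrow> 'a set set \<Rightarrow> 'b set set \<Rightarrow> ('a \<Rightarrow> 'b) \<Rightarrow> ('a \<Rightarrow> 'b) \<Rightarrow> bool" where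
  "same_contiguity_class m K L f g \<longleftrightarrow>
     (\<exists>F :: nat \<Rightarrow> 'a \<Rightarrow> 'b.
        (\<forall>i\<le>m. simplicial_map K L (F i)) \<and>
        (\<forall>v\<in>vertices K. F 0 v = f v) \<and>
        (\<forall>v\<in>vertices K. F m v = g v) \<and>
        (\<forall>i<m. contiguous K L (F i) (F (Suc i))))"

definition interval_complex :: "nat \<Rightarrow> nat set set" where
  "interval_complex m = {{j} | j. j \<le> m} \<union> {{j, Suc j} | j. j < m}"

definition point_complex :: "'a \<Rightarrow> 'a set set" where
  "point_complex a = {{a}}"

definition complex_product :: "'a set set \<Rightarrow> 'b set set \<Rightarrow> ('a \<times> 'b) set set" where
  "complex_product K L =
     {\<sigma>. finite \<sigma> \<and> \<sigma> \<subseteq> vertices K \<times> vertices L \<and> fst ` \<sigma> \<in> K \<and> snd ` \<sigma> \<in> L}"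

lemma simplicial_complex_interval: "simplicial_complex (interval_complex m)"
proof -
  have "\<tau> \<in> interval_complex m"
    if "\<sigma> \<in> interval_complex m" "\<tau> \<subseteq> \<sigma>" "\<tau> \<noteq> {}" for \<sigma> \<tau>
  proof -
    from that(1) consider j where "\<sigma> = {j}" "j \<le> m" | j where "\<sigma> = {j, Suc j}" "j < m"
      unfolding interval_complex_def by blast
    then show ?thesis
    proof cases
      case 1
      with that have "\<tau> = {j}" by blast
      with 1 show ?thesis unfolding interval_complex_def by blast
    next
      case 2
      with that have "\<tau> = {j} \<or> \<tau> = {Suc j} \<or> \<tau> = {j, Suc j}" by blast
      moreover have "j \<le> m" "Suc j \<le> m" using 2 by simp_all
      ultimately show ?thesis using 2 unfolding interval_complex_def by blast
    qed
  qed
  moreover have "finite \<sigma> \<and> \<sigma> \<noteq> {}" if "\<sigma> \<in> interval_complex m" for \<sigma>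
    using that unfolding interval_complex_def by blast
  ultimately show ?thesis
    unfolding simplicial_complex_def by blast
qed

lemma vertices_interval: "vertices (interval_complex m) = {0..m}"
proof (intro set_eqI iffI)
  fix x assume "x \<in> vertices (interval_complex m)"
  then show "x \<in> {0..m}"
    unfolding vertices_def interval_complex_def by fastforce
next
  fix x assume "x \<in> {0..m}"
  then have "{x} \<in> interval_complex m"
    unfolding interval_complex_def by simp
  then show "x \<in> vertices (interval_complex m)"
    unfolding vertices_def by blast
qed

lemma singleton_in_complex:
  assumes "simplicial_complex K" "v \<in> vertices K"
  shows "{v} \<in> K"
proof -
  obtain \<sigma> where "v \<in> \<sigma>" "\<sigma> \<in> K"
    using assms(2) unfolding vertices_def by (rule UnionE)
  moreover from \<open>v \<in> \<sigma>\<close> have "{v} \<subseteq> \<sigma>" "{v} \<noteq> {}" by simp_all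
  ultimately show ?thesis
    using assms(1) unfolding simplicial_complex_def by meson
qed

lemma simplicial_complex_product:
  assumes "simplicial_complex K" "simplicial_complex L"
  shows "simplicial_complex (complex_product K L)"
proof -
  have "\<tau> \<in> complex_product K L"
    if "\<sigma> \<in> complex_product K L" "\<tau> \<subseteq> \<sigma>" "\<tau> \<noteq> {}" for \<sigma> \<tau>
  proof -
    have "fst ` \<tau> \<in> K" "snd ` \<tau> \<in> L"
      using that assms unfolding complex_product_def simplicial_complex_def
      by (metis (no_types, lifting) image_is_empty image_mono mem_Collect_eq)+
    moreover have "finite \<tau>" "\<tau> \<subseteq> vertices K \<times> vertices L"
      using that unfolding complex_product_def by (blast intro: finite_subset)+
    ultimately show ?thesis
      unfolding complex_product_def by blast
  qed
  moreover have "finite \<sigma> \<and> \<sigma> \<noteq> {}" if "\<sigma> \<in> complex_product K L" for \<sigma>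
    using that assms unfolding complex_product_def simplicial_complex_def by blast
  ultimately show ?thesis
    unfolding simplicial_complex_def by blast
qed

lemma vertices_product:
  assumes "simplicial_complex K" "simplicial_complex L"
  shows "vertices (complex_product K L) = vertices K \<times> vertices L"
proof
  show "vertices (complex_product K L) \<subseteq> vertices K \<times> vertices L"
  proof
    fix x assume "x \<in> vertices (complex_product K L)"
    then obtain \<sigma> where "x \<in> \<sigma>" "\<sigma> \<in> complex_product K L"
      unfolding vertices_def by (rule UnionE)
    then show "x \<in> vertices K \<times> vertices L"
      unfolding complex_product_def by blast
  qed
  show "vertices K \<times> vertices L \<subseteq> vertices (complex_product K L)"
  proof
    fix x assume "x \<in> vertices K \<times> vertices L"
    then have "{x} \<in> complex_product K L"
      using assms singleton_in_complex[of K "fst x"] singleton_in_complex[of L "snd x"]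
      by (simp add: complex_product_def mem_Times_iff)
    then show "x \<in> vertices (complex_product K L)"
      unfolding vertices_def by blast
  qed
qed

text \<open>
  In the three lifting properties, \<open>K\<close> ranges over all complexes, finite or infinite, with vertices
  in the type \<open>'k\<close>. HOL cannot quantify over types inside a formula, so this type is passed as
  an argument; letting the type variable \<open>'k\<close> vary accounts for every complex \<open>K\<close>.
\<close>

definition type_I ::
  "'k itself \<Rightarrow> 'e set set \<Rightarrow> 'b set set \<Rightarrow> ('e \<Rightarrow> 'b) \<Rightarrow> bool" where
  "type_I T E B p \<longleftrightarrow>
     (\<forall>K :: 'k set set. simplicial_complex K \<longrightarrow>
       (\<forall>f g f'.
          simplicial_map K B f \<and> simplicial_map K B g \<and> contiguous K B f g \<and>
          simplicial_map K E f' \<and> (\<forall>v\<in>vertices K. p (f' v) = f v) \<longrightarrow>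
          (\<exists>g'. simplicial_map K E g' \<and> contiguous K E f' g' \<and>
                (\<forall>v\<in>vertices K. p (g' v) = g v))))"

definition type_II ::
  "'k itself \<Rightarrow> 'e set set \<Rightarrow> 'b set set \<Rightarrow> ('e \<Rightarrow> 'b) \<Rightarrow> bool" where
  "type_II T E B p \<longleftrightarrow>
     (\<forall>K :: 'k set set. simplicial_complex K \<longrightarrow>
       (\<forall>m\<ge>1. \<forall>f g f'.
          simplicial_map K B f \<and> simplicial_map K B g \<and> same_contiguity_class m K B f g \<and>
          simplicial_map K E f' \<and> (\<forall>v\<in>vertices K. p (f' v) = f v) \<longrightarrow>
          (\<exists>g'. simplicial_map K E g' \<and> same_contiguity_class m K E f' g' \<and>
                (\<forall>v\<in>vertices K. p (g' v) = g v))))"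

definition type_III ::
  "'k itself \<Rightarrow> 'e set set \<Rightarrow> 'b set set \<Rightarrow> ('e \<Rightarrow> 'b) \<Rightarrow> bool" where
  "type_III T E B p \<longleftrightarrow>
     (\<forall>K :: 'k set set. simplicial_complex K \<longrightarrow>
       (\<forall>m\<ge>1. \<forall>(H :: 'k \<times> nat \<Rightarrow> 'b) (\<phi> :: 'k \<times> nat \<Rightarrow> 'e).
          simplicial_map (complex_product K (interval_complex m)) B H \<and>
          simplicial_map (complex_product K (point_complex 0)) E \<phi> \<and>
          (\<forall>v\<in>vertices K. p (\<phi> (v, 0)) = H (v, 0)) \<longrightarrow>
          (\<exists>H'. simplicial_map (complex_product K (interval_complex m)) E H' \<and>
                (\<forall>v\<in>vertices K. H' (v, 0) = \<phi> (v, 0)) \<and>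
                (\<forall>x\<in>vertices (complex_product K (interval_complex m)). p (H' x) = H x))))"

end

theory Submission
  imports Defs
begin

text \<open>
  A simplicial map on \<open>K \<times> I\<^sub>m\<close> is the same thing as a chain of \<open>m + 1\<close> maps on \<open>K\<close>, each
  contiguous to the next. Type I lifts such a chain one contiguity at a time, and the lifted chain
  yields both type II and type III; conversely type I is the case \<open>m = 1\<close> of either.
\<close>

section \<open>Simplicial maps and simplices of products\<close>

lemma simplicial_map_cong:
  assumes "\<And>v. v \<in> vertices K \<Longrightarrow> f v = f' v"
  shows "simplicial_map K L f \<longleftrightarrow> simplicial_map K L f'"
proof -
  have "f ` \<sigma> = f' ` \<sigma>" if "\<sigma> \<in> K" for \<sigma>
    using that assms by (auto simp: vertices_def intro!: image_cong)
  then show ?thesis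
    using assms by (simp add: simplicial_map_def)
qed

text \<open>Each simplex consists of vertices, so values elsewhere do not enter. This is needed
  because the ends of a chain and the start of a lifted homotopy are prescribed on vertices
  only.\<close>

lemma contiguous_cong:
  assumes "\<And>v. v \<in> vertices K \<Longrightarrow> f v = f' v" and "\<And>v. v \<in> vertices K \<Longrightarrow> g v = g' v"
  shows "contiguous K L f g \<longleftrightarrow> contiguous K L f' g'"
proof -
  have "f ` \<sigma> = f' ` \<sigma>" "g ` \<sigma> = g' ` \<sigma>" if "\<sigma> \<in> K" for \<sigma>
    using that assms by (auto simp: vertices_def intro!: image_cong)
  then show ?thesis
    using assms simplicial_map_cong[of K f f' L] simplicial_map_cong[of K g g' L]
    by (simp add: contiguous_def)
qed

text \<open>Every vertex lies in a simplex, whose image is a simplex of \<open>L\<close>; this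
  already puts the image of the vertex among the vertices of \<open>L\<close>.\<close>

lemma simplicial_mapI:
  assumes "\<And>\<sigma>. \<sigma> \<in> K \<Longrightarrow> f ` \<sigma> \<in> L"
  shows "simplicial_map K L f"
  using assms unfolding simplicial_map_def vertices_def by blast

lemma simplex_subset_vertices: "\<sigma> \<in> K \<Longrightarrow> \<sigma> \<subseteq> vertices K"
  unfolding vertices_def by blast

lemma simplex_face:
  assumes "simplicial_complex K" "\<sigma> \<in> K" "\<tau> \<subseteq> \<sigma>" "\<tau> \<noteq> {}"
  shows "\<tau> \<in> K"
  using assms unfolding simplicial_complex_def by blast

text \<open>This is where the product being the categorical one matters: the whole box projects onto
  its two factors. Images of boxes over a point or an edge then express slices and
  contiguity.\<close>

lemma Times_in_complex_product:
  assumes "simplicial_complex K" "simplicial_complex L" "\<sigma> \<in> K" "\<tau> \<in> L"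
  shows "\<sigma> \<times> \<tau> \<in> complex_product K L"
proof -
  have "finite \<sigma>" "\<sigma> \<noteq> {}" "finite \<tau>" "\<tau> \<noteq> {}"
    using assms unfolding simplicial_complex_def by blast+
  then show ?thesis
    using assms(3,4) simplex_subset_vertices[of \<sigma> K] simplex_subset_vertices[of \<tau> L]
    by (auto simp: complex_product_def)
qed

section \<open>Simplicial maps on cylinders\<close>

lemma simplicial_map_slice:
  assumes "simplicial_complex K" "simplicial_complex J" "{j} \<in> J"
    and "simplicial_map (complex_product K J) L H"
  shows "simplicial_map K L (\<lambda>v. H (v, j))"
proof (rule simplicial_mapI)
  fix \<sigma> assume "\<sigma> \<in> K"
  then have "H ` (\<sigma> \<times> {j}) \<in> L"
    using assms Times_in_complex_product[of K J \<sigma> "{j}"] by (auto simp: simplicial_map_def)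
  moreover have "H ` (\<sigma> \<times> {j}) = (\<lambda>v. H (v, j)) ` \<sigma>"
    by auto
  ultimately show "(\<lambda>v. H (v, j)) ` \<sigma> \<in> L"
    by simp
qed

text \<open>The box over an edge \<open>{i, Suc i}\<close> maps onto the union of the images under
  two neighbouring slices, which gives contiguity. Conversely, every simplex of the cylinder lies in
  a box over a vertex or an edge of the interval, so its image is a face of a simplex of
  \<open>L\<close>.\<close>

lemma simplicial_map_cylinder_iff:
  assumes K: "simplicial_complex K" and L: "simplicial_complex L"
  shows "simplicial_map (complex_product K (interval_complex m)) L H \<longleftrightarrow>
    (\<forall>i\<le>m. simplicial_map K L (\<lambda>v. H (v, i))) \<and>
    (\<forall>i<m. contiguous K L (\<lambda>v. H (v, i)) (\<lambda>v. H (v, Suc i)))"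
    (is "?map \<longleftrightarrow> ?slices \<and> ?steps")
proof
  assume map: ?map
  note I = simplicial_complex_interval[of m]
  have slices: ?slices
    using map by (auto intro!: simplicial_map_slice[OF K I] simp: interval_complex_def)
  moreover have "(\<lambda>v. H (v, i)) ` \<sigma> \<union> (\<lambda>v. H (v, Suc i)) ` \<sigma> \<in> L" if "i < m" "\<sigma> \<in> K" for i \<sigma>
  proof -
    have "{i, Suc i} \<in> interval_complex m"
      using that by (auto simp: interval_complex_def)
    then have "H ` (\<sigma> \<times> {i, Suc i}) \<in> L"
      using map Times_in_complex_product[OF K I that(2)] by (auto simp: simplicial_map_def)
    moreover have "H ` (\<sigma> \<times> {i, Suc i}) = (\<lambda>v. H (v, i)) ` \<sigma> \<union> (\<lambda>v. H (v, Suc i)) ` \<sigma>"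
      by auto
    ultimately show ?thesis
      by simp
  qed
  ultimately show "?slices \<and> ?steps"
    by (auto simp: contiguous_def)
next
  assume chain: "?slices \<and> ?steps"
  show ?map
  proof (rule simplicial_mapI)
    fix \<sigma> assume "\<sigma> \<in> complex_product K (interval_complex m)"
    then have fst: "fst ` \<sigma> \<in> K" and snd: "snd ` \<sigma> \<in> interval_complex m"
      by (auto simp: complex_product_def)
    \<comment> \<open>Faces must be nonempty, as the empty set does not count as a simplex.\<close>
    have ne: "H ` \<sigma> \<noteq> {}"
      using fst K by (auto simp: simplicial_complex_def)
    from snd consider j where "snd ` \<sigma> = {j}" "j \<le> m" | j where "snd ` \<sigma> = {j, Suc j}" "j < m"
      by (auto simp: interval_complex_def)
    then show "H ` \<sigma> \<in> L"
    proof cases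
      case 1
      \<comment> \<open>A simplex of the product lies in the box spanned by its two
        projections.\<close>
      then have "\<sigma> \<subseteq> fst ` \<sigma> \<times> {j}"
        by (metis subset_fst_snd)
      then have "H ` \<sigma> \<subseteq> (\<lambda>v. H (v, j)) ` (fst ` \<sigma>)"
        by auto
      moreover have "(\<lambda>v. H (v, j)) ` (fst ` \<sigma>) \<in> L"
        using chain 1 fst by (simp only: simplicial_map_def)
      ultimately show ?thesis
        using simplex_face[OF L] ne by blast
    next
      case 2
      then have "\<sigma> \<subseteq> fst ` \<sigma> \<times> {j, Suc j}"
        by (metis subset_fst_snd)
      then have "H ` \<sigma> \<subseteq> (\<lambda>v. H (v, j)) ` (fst ` \<sigma>) \<union> (\<lambda>v. H (v, Suc j)) ` (fst ` \<sigma>)"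
        by fastforce
      moreover have "(\<lambda>v. H (v, j)) ` (fst ` \<sigma>) \<union> (\<lambda>v. H (v, Suc j)) ` (fst ` \<sigma>) \<in> L"
        using chain 2 fst by (simp only: contiguous_def)
      ultimately show ?thesis
        using simplex_face[OF L] ne by blast
    qed
  qed
qed

section \<open>Lifting chains of contiguous maps\<close>

lemma type_I_lift_step:
  fixes K :: "'k set set"
  assumes "type_I TYPE('k) E B p" "simplicial_complex K" "contiguous K B f g"
    and "simplicial_map K E f'" "\<forall>v\<in>vertices K. p (f' v) = f v"
  shows "\<exists>g'. contiguous K E f' g' \<and> (\<forall>v\<in>vertices K. p (g' v) = g v)"
proof -
  have "simplicial_map K B f" "simplicial_map K B g"
    using assms(3) by (simp_all add: contiguous_def)
  then show ?thesis
    using assms unfolding type_I_def by blast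
qed

text \<open>By induction on \<open>m\<close>: the last lift found so far is the starting lift for
  the next contiguity. The chain \<open>G\<close> lies over \<open>F\<close> at every index, as type
  III requires; type II uses only its last map.\<close>

lemma type_I_lift_chain:
  fixes K :: "'k set set"
  assumes type_I: "type_I TYPE('k) E B p" and K: "simplicial_complex K"
    and f': "simplicial_map K E f'" "\<forall>v\<in>vertices K. p (f' v) = F 0 v"
    and "\<forall>i<m. contiguous K B (F i) (F (Suc i))"
  shows "\<exists>G. G 0 = f' \<and> (\<forall>i\<le>m. simplicial_map K E (G i)) \<and>
    (\<forall>i\<le>m. \<forall>v\<in>vertices K. p (G i v) = F i v) \<and>
    (\<forall>i<m. contiguous K E (G i) (G (Suc i)))"
  using assms(5)
proof (induction m)
  case 0
  then show ?case
    using f' by (intro exI[of _ "\<lambda>_. f'"]) simp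
next
  case (Suc m)
  then obtain G where G: "G 0 = f'" "\<forall>i\<le>m. simplicial_map K E (G i)"
    "\<forall>i\<le>m. \<forall>v\<in>vertices K. p (G i v) = F i v"
    "\<forall>i<m. contiguous K E (G i) (G (Suc i))"
    by (auto simp: less_Suc_eq)
  have "\<exists>g. contiguous K E (G m) g \<and> (\<forall>v\<in>vertices K. p (g v) = F (Suc m) v)"
  proof (rule type_I_lift_step[OF type_I K])
    show "contiguous K B (F m) (F (Suc m))" "simplicial_map K E (G m)"
      "\<forall>v\<in>vertices K. p (G m v) = F m v"
      using Suc.prems G by simp_all
  qed
  then obtain g where g: "contiguous K E (G m) g" "\<forall>v\<in>vertices K. p (g v) = F (Suc m) v"
    by (elim exE conjE)
  have "simplicial_map K E g"
    using g(1) by (simp add: contiguous_def)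
  then show ?case
    \<comment> \<open>Updating at \<open>Suc m\<close> leaves the maps up to index \<open>m\<close>,
      and so the contiguities already obtained, unchanged.\<close>
    using G g by (intro exI[of _ "G(Suc m := g)"]) (auto simp: le_Suc_eq less_Suc_eq)
qed

section \<open>Implications between the lifting properties\<close>

lemma type_I_imp_type_II:
  assumes "type_I TYPE('k) E B p"
  shows "type_II TYPE('k) E B p"
  unfolding type_II_def
proof (intro allI impI, elim conjE)
  fix K :: "'k set set" and m :: nat and f g f'
  assume K: "simplicial_complex K" and same: "same_contiguity_class m K B f g"
    and f': "simplicial_map K E f'" "\<forall>v\<in>vertices K. p (f' v) = f v"
  from same obtain F where F: "\<forall>v\<in>vertices K. F 0 v = f v" "\<forall>v\<in>vertices K. F m v = g v"
    "\<forall>i<m. contiguous K B (F i) (F (Suc i))"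
    unfolding same_contiguity_class_def by blast
  have "\<forall>v\<in>vertices K. p (f' v) = F 0 v"
    using f'(2) F(1) by simp
  from type_I_lift_chain[where F = F, OF assms K f'(1) this F(3)]
  obtain G where G: "G 0 = f'" "\<forall>i\<le>m. simplicial_map K E (G i)"
    "\<forall>i\<le>m. \<forall>v\<in>vertices K. p (G i v) = F i v"
    "\<forall>i<m. contiguous K E (G i) (G (Suc i))"
    by (elim exE conjE)
  \<comment> \<open>The end of the lifted chain serves as the lift of \<open>g\<close>.\<close>
  have "same_contiguity_class m K E f' (G m)"
    using G unfolding same_contiguity_class_def by (intro exI[of _ G]) simp
  then show "\<exists>g'. simplicial_map K E g' \<and> same_contiguity_class m K E f' g' \<and>
      (\<forall>v\<in>vertices K. p (g' v) = g v)"
    using G(2,3) F(2) by (intro exI[of _ "G m"]) simp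
qed

lemma same_contiguity_class_1_iff:
  "same_contiguity_class 1 K L f g \<longleftrightarrow> contiguous K L f g"
proof
  assume "same_contiguity_class 1 K L f g"
  then obtain F where F: "\<forall>v\<in>vertices K. F 0 v = f v" "\<forall>v\<in>vertices K. F 1 v = g v"
    "contiguous K L (F 0) (F (Suc 0))"
    unfolding same_contiguity_class_def One_nat_def by blast
  then show "contiguous K L f g"
    using contiguous_cong[of K "F 0" f "F 1" g] by simp
next
  assume "contiguous K L f g"
  then show "same_contiguity_class 1 K L f g"
    unfolding same_contiguity_class_def
    \<comment> \<open>Only the indices 0 and 1 matter, so the constant value \<open>g\<close> from 1
      on is harmless.\<close>
    by (intro exI[of _ "\<lambda>i. if i = 0 then f else g"]) (simp add: contiguous_def)
qed

text \<open>Take \<open>m = 1\<close>: a single step in a contiguity class is a contiguity.\<close>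

lemma type_II_imp_type_I:
  assumes "type_II TYPE('k) E B p"
  shows "type_I TYPE('k) E B p"
  using assms unfolding type_I_def type_II_def
  by (metis same_contiguity_class_1_iff order_refl)

text \<open>The slices of \<open>H\<close> form a chain in \<open>B\<close>. Lifting it from the
  slice of \<open>\<phi>\<close> at 0 and stacking the lifts gives the lifted homotopy.\<close>

lemma type_I_imp_type_III:
  assumes type_I: "type_I TYPE('k) E B p"
    and E: "simplicial_complex E" and B: "simplicial_complex B"
  shows "type_III TYPE('k) E B p"
  unfolding type_III_def
proof (intro allI impI, elim conjE)
  fix K :: "'k set set" and m :: nat and H \<phi>
  assume K: "simplicial_complex K"
    and H: "simplicial_map (complex_product K (interval_complex m)) B H"
    and \<phi>: "simplicial_map (complex_product K (point_complex (0::nat))) E \<phi>"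
    and p\<phi>: "\<forall>v\<in>vertices K. p (\<phi> (v, 0)) = H (v, 0)"
  have point: "simplicial_complex (point_complex (0::nat))"
    by (auto simp: point_complex_def simplicial_complex_def)
  have \<phi>0: "simplicial_map K E (\<lambda>v. \<phi> (v, 0))"
    by (rule simplicial_map_slice[OF K point _ \<phi>]) (simp add: point_complex_def)
  have "\<forall>i<m. contiguous K B (\<lambda>v. H (v, i)) (\<lambda>v. H (v, Suc i))"
    using H simplicial_map_cylinder_iff[OF K B] by blast
  from type_I_lift_chain[where F = "\<lambda>i v. H (v, i)", OF type_I K \<phi>0 p\<phi> this]
  obtain G where G: "G 0 = (\<lambda>v. \<phi> (v, 0))" "\<forall>i\<le>m. simplicial_map K E (G i)"
    "\<forall>i\<le>m. \<forall>v\<in>vertices K. p (G i v) = H (v, i)"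
    "\<forall>i<m. contiguous K E (G i) (G (Suc i))"
    by (elim exE conjE)
  show "\<exists>H'. simplicial_map (complex_product K (interval_complex m)) E H' \<and>
      (\<forall>v\<in>vertices K. H' (v, 0) = \<phi> (v, 0)) \<and>
      (\<forall>x\<in>vertices (complex_product K (interval_complex m)). p (H' x) = H x)"
  proof (intro exI conjI)
    let ?H' = "\<lambda>(v, i). G i v"
    show "simplicial_map (complex_product K (interval_complex m)) E ?H'"
      using G(2,4) by (simp add: simplicial_map_cylinder_iff[OF K E])
    show "\<forall>v\<in>vertices K. ?H' (v, 0) = \<phi> (v, 0)"
      using G(1) by simp
    show "\<forall>x\<in>vertices (complex_product K (interval_complex m)). p (?H' x) = H x"
      using G(3)
      by (auto simp: vertices_product[OF K simplicial_complex_interval] vertices_interval)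
  qed
qed

text \<open>A contiguous pair is a simplicial map on the cylinder of length 1; the slice at 1 of a
  lift of that map is the lift of \<open>g\<close>.\<close>

lemma type_III_imp_type_I:
  assumes type_III: "type_III TYPE('k) E B p"
    and E: "simplicial_complex E" and B: "simplicial_complex B"
  shows "type_I TYPE('k) E B p"
  unfolding type_I_def
proof (intro allI impI, elim conjE)
  fix K :: "'k set set" and f g f'
  assume K: "simplicial_complex K" and fg: "contiguous K B f g"
    and f': "simplicial_map K E f'" "\<forall>v\<in>vertices K. p (f' v) = f v"
  let ?C = "complex_product K (interval_complex 1)"
  let ?H = "\<lambda>(v, i::nat). if i = 0 then f v else g v"
  let ?\<phi> = "\<lambda>(v, i::nat). f' v"
  have "simplicial_map ?C B ?H"
    using fg by (simp add: simplicial_map_cylinder_iff[OF K B] contiguous_def le_Suc_eq)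
  \<comment> \<open>\<open>?\<phi>\<close> ignores the second coordinate, so it maps a simplex to
    the image under \<open>f'\<close> of its projection to \<open>K\<close>.\<close>
  moreover have "simplicial_map (complex_product K (point_complex 0)) E ?\<phi>"
  proof (rule simplicial_mapI)
    fix \<sigma> assume "\<sigma> \<in> complex_product K (point_complex (0::nat))"
    then have "f' ` fst ` \<sigma> \<in> E"
      using f'(1) by (simp add: complex_product_def simplicial_map_def)
    then show "?\<phi> ` \<sigma> \<in> E"
      by (simp add: image_image case_prod_beta)
  qed
  moreover have "\<forall>v\<in>vertices K. p (?\<phi> (v, 0)) = ?H (v, 0)"
    using f'(2) by simp
  \<comment> \<open>Here \<open>order_refl\<close> proves \<open>1 \<le> 1\<close> and thereby fixes
    the length of the interval as 1.\<close>
  ultimately obtain H' where H': "simplicial_map ?C E H'"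
    "\<forall>v\<in>vertices K. H' (v, 0) = ?\<phi> (v, 0)" "\<forall>x\<in>vertices ?C. p (H' x) = ?H x"
    using type_III[unfolded type_III_def, rule_format, OF K order_refl, of ?H ?\<phi>] by blast
  let ?g' = "\<lambda>v. H' (v, 1)"
  have "contiguous K E (\<lambda>v. H' (v, 0)) ?g'"
    using H'(1) by (simp add: simplicial_map_cylinder_iff[OF K E])
  \<comment> \<open>The slice of \<open>H'\<close> at 0 agrees with \<open>f'\<close> on vertices
    only, so it is exchanged by congruence.\<close>
  then have "contiguous K E f' ?g'"
    using H'(2) contiguous_cong[of K "\<lambda>v. H' (v, 0)" f' ?g' ?g'] by simp
  moreover have "\<forall>v\<in>vertices K. p (?g' v) = g v"
    using H'(3) by (simp add: vertices_product[OF K simplicial_complex_interval] vertices_interval)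
  ultimately show "\<exists>g'. simplicial_map K E g' \<and> contiguous K E f' g' \<and>
      (\<forall>v\<in>vertices K. p (g' v) = g v)"
    by (auto simp: contiguous_def)
qed

theorem theorem3p4:
  fixes E :: "'e set set" and B :: "'b set set" and p :: "'e \<Rightarrow> 'b"
  assumes "simplicial_complex E" and "simplicial_complex B" and "simplicial_map E B p"
  shows "(type_I TYPE('k) E B p \<longleftrightarrow> type_II TYPE('k) E B p) \<and>
         (type_II TYPE('k) E B p \<longleftrightarrow> type_III TYPE('k) E B p)"
  \<comment> \<open>Types II and III are compared through type I. Each implication treats one
    complex \<open>K\<close> at a time, so the vertex type \<open>'k\<close> stays the same
    throughout.\<close>
  using assms type_I_imp_type_II type_II_imp_type_I type_I_imp_type_III type_III_imp_type_I
  by metis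

end
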